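(* Let $n\ge1$ and let $\Delta_n:=\{(y_1,\ldots,y_n)\in\mathbb{R}^n:\ 0\le y_1,\ldots,0\le y_n,\ y_1+\cdots+y_n\le1\}$ be the $n$-simplex whose vertices are the origin and the points $e_i:=(0,\ldots,0,1,0,\ldots,0)$ (with $1$ in the $i$-th position), $i=1,\ldots,n$. Then $\Delta_n$ is an $n$-brick.
   Context: $\overline{B}_m$ denotes the closed unit ball of $\mathbb{R}^m$ centered at the origin. An $n$-dimensional semialgebraic set $T\subset\mathbb{R}^n$ is an $m$-brick if there exists a homotopy $H=(H_1,\ldots,H_n):[0,1]\times\overline{B}_m\to T$ such that: (1) each $H_i$ is the restriction to $[0,1]\times\overline{B}_m$ of a polynomial of the ring $\mathcal{C}^0([0,1])[x_1,\ldots,x_m]$, where $\mathcal{C}^0([0,1])$ is the ring of continuous real functions on $[0,1]$; (2) $H(\{0\}\times\overline{B}_m)=T$ and $H(1,\cdot)$ is a constant map; (3) $H(\{t\}\times\overline{B}_m)\subset\operatorname{Int}(T)$ for each $t\in(0,1)$, where $\operatorname{Int}$ is the topological interior in $\mathbb{R}^n$. *)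

theory Defs
  imports
    "HOL-Analysis.Analysis"
    "HOL-Algebra.Ideal"
    "HOL-Library.Extended_Nat"
begin

text \<open>
  The predicate \<^const>\<open>real_polynomial_function\<close> is closed under sums and products and contains
  the constants and the bounded linear functionals; on \<open>real ^ 'n\<close> it therefore describes
  exactly the functions given by real polynomials in the coordinates.
\<close>

inductive semialgebraic :: "(real ^ 'n) set \<Rightarrow> bool" where
  semialgebraic_eq: "real_polynomial_function f \<Longrightarrow> semialgebraic {x. f x = 0}"
| semialgebraic_pos: "real_polynomial_function f \<Longrightarrow> semialgebraic {x. f x > 0}"
| semialgebraic_Un: "semialgebraic S \<Longrightarrow> semialgebraic T \<Longrightarrow> semialgebraic (S \<union> T)"
| semialgebraic_Int: "semialgebraic S \<Longrightarrow> semialgebraic T \<Longrightarrow> semialgebraic (S \<inter> T)"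
| semialgebraic_Compl: "semialgebraic S \<Longrightarrow> semialgebraic (- S)"

text \<open>
  The ring of polynomial functions on \<open>S\<close>, that is \<open>\<real>[x\<^sub>1,\<dots>,x\<^sub>n] / I(S)\<close> where \<open>I(S)\<close> is the ideal
  of the polynomials vanishing on \<open>S\<close>: the class of a polynomial is represented by its restriction
  to \<open>S\<close>.
\<close>

definition poly_fun_ring :: "(real ^ 'n) set \<Rightarrow> (real ^ 'n \<Rightarrow> real) ring" where
  "poly_fun_ring S =
     \<lparr>carrier = {restrict f S | f. real_polynomial_function f},
      monoid.mult = (\<lambda>f g. restrict (\<lambda>x. f x * g x) S),
      one = restrict (\<lambda>_. 1) S,
      zero = restrict (\<lambda>_. 0) S,
      add = (\<lambda>f g. restrict (\<lambda>x. f x + g x) S)\<rparr>"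

lemma cring_poly_fun_ring: "cring (poly_fun_ring S)"
proof (rule cringI)
  show "abelian_group (poly_fun_ring S)"
  proof (rule abelian_groupI)
    fix x y assume "x \<in> carrier (poly_fun_ring S)" "y \<in> carrier (poly_fun_ring S)"
    then obtain f g where "x = restrict f S" "y = restrict g S"
      "real_polynomial_function f" "real_polynomial_function g"
      by (auto simp: poly_fun_ring_def)
    then show "x \<oplus>\<^bsub>poly_fun_ring S\<^esub> y \<in> carrier (poly_fun_ring S)"
      by (auto simp: poly_fun_ring_def fun_eq_iff
          intro!: exI[of _ "\<lambda>x. f x + g x"] real_polynomial_function.intros(3))
  next
    fix x assume "x \<in> carrier (poly_fun_ring S)"
    then obtain f where "x = restrict f S" "real_polynomial_function f"
      by (auto simp: poly_fun_ring_def)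
    then show "\<exists>y\<in>carrier (poly_fun_ring S). y \<oplus>\<^bsub>poly_fun_ring S\<^esub> x = \<zero>\<^bsub>poly_fun_ring S\<^esub>"
      by (intro bexI[of _ "restrict (\<lambda>x. - f x) S"])
        (auto simp: poly_fun_ring_def fun_eq_iff)
  qed (auto simp: poly_fun_ring_def fun_eq_iff
      intro!: exI[of _ "\<lambda>_. 0"] real_polynomial_function.intros(2))
next
  show "comm_monoid (poly_fun_ring S)"
  proof (rule comm_monoidI)
    fix x y assume "x \<in> carrier (poly_fun_ring S)" "y \<in> carrier (poly_fun_ring S)"
    then obtain f g where "x = restrict f S" "y = restrict g S"
      "real_polynomial_function f" "real_polynomial_function g"
      by (auto simp: poly_fun_ring_def)
    then show "x \<otimes>\<^bsub>poly_fun_ring S\<^esub> y \<in> carrier (poly_fun_ring S)"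
      by (auto simp: poly_fun_ring_def fun_eq_iff
          intro!: exI[of _ "\<lambda>x. f x * g x"] real_polynomial_function.intros(4))
  qed (auto simp: poly_fun_ring_def fun_eq_iff
      intro!: exI[of _ "\<lambda>_. 1"] real_polynomial_function.intros(2))
qed (auto simp: poly_fun_ring_def fun_eq_iff algebra_simps)

definition krull_dim :: "('a, 'b) ring_scheme \<Rightarrow> enat" where
  "krull_dim R = Sup {enat k | k. \<exists>P :: nat \<Rightarrow> 'a set.
     (\<forall>i\<le>k. primeideal (P i) R) \<and> (\<forall>i<k. P i \<subset> P (Suc i))}"

text \<open>
  The empty set gets dimension \<open>0\<close> here instead of \<open>-1\<close> or \<open>-\<infinity>\<close>. This is harmless, since below
  the dimension is only required to be the positive number \<^term>\<open>CARD('n)\<close>.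
\<close>

definition semialgebraic_dim :: "(real ^ 'n) set \<Rightarrow> enat" where
  "semialgebraic_dim S = krull_dim (poly_fun_ring S)"

text \<open>
  The polynomials of the ring \<open>C\<^sup>0([0,1])[x\<^sub>1,\<dots>,x\<^sub>m]\<close>, as functions on \<open>[0,1] \<times> \<real>\<^sup>m\<close>: \<open>A\<close> is a
  finite set of exponent vectors, and \<open>c \<alpha>\<close> is the coefficient of the monomial with exponent
  vector \<open>\<alpha>\<close>.
\<close>

definition continuous_coeff_polynomial :: "(real \<Rightarrow> real ^ 'm \<Rightarrow> real) \<Rightarrow> bool" where
  "continuous_coeff_polynomial p \<longleftrightarrow>
     (\<exists>(A :: ('m \<Rightarrow> nat) set) c. finite A \<and> (\<forall>\<alpha>\<in>A. continuous_on {0..1} (c \<alpha>)) \<and>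
        (\<forall>t\<in>{0..1}. \<forall>x. p t x = (\<Sum>\<alpha>\<in>A. c \<alpha> t * (\<Prod>j\<in>UNIV. (x $ j) ^ \<alpha> j))))"

text \<open>
  \<open>brick TYPE('m) T\<close> says that \<open>T\<close> is an \<open>m\<close>-brick for \<open>m = CARD('m)\<close>.
\<close>

definition brick :: "'m::finite itself \<Rightarrow> (real ^ 'n) set \<Rightarrow> bool" where
  "brick _ T \<longleftrightarrow>
     semialgebraic T \<and> semialgebraic_dim T = enat CARD('n) \<and>
     (\<exists>H :: real \<times> (real ^ 'm) \<Rightarrow> real ^ 'n.
        continuous_on ({0..1} \<times> cball 0 1) H \<and>
        H ` ({0..1} \<times> cball 0 1) \<subseteq> T \<and>
        (\<forall>i. \<exists>p. continuous_coeff_polynomial p \<and>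
           (\<forall>t\<in>{0..1}. \<forall>x\<in>cball 0 1. H (t, x) $ i = p t x)) \<and>
        H ` ({0} \<times> cball 0 1) = T \<and>
        (\<exists>a. \<forall>x\<in>cball 0 1. H (1, x) = a) \<and>
        (\<forall>t\<in>{0<..<1}. H ` ({t} \<times> cball 0 1) \<subseteq> interior T))"

definition std_simplex :: "(real ^ 'n) set" where
  "std_simplex = {y. (\<forall>i. 0 \<le> y $ i) \<and> (\<Sum>i\<in>UNIV. y $ i) \<le> 1}"

end

theory Submission
  imports Defs
begin

text \<open>
  The squaring map \<open>x \<mapsto> (x\<^sub>1\<^sup>2, \<dots>, x\<^sub>n\<^sup>2)\<close> carries the unit ball onto the simplex, because
  \<open>\<parallel>x\<parallel> \<le> 1\<close> says exactly that the squares add up to at most \<open>1\<close>. Moving its values along straight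
  lines to the interior point \<open>(1/(n+1), \<dots>, 1/(n+1))\<close> gives the homotopy: a convex
  combination of a point of the simplex with an interior point, the latter with positive weight,
  is interior (\<open>squares_image_cball\<close>, \<open>shrinking_squares_interior\<close>).

  The real work is the dimension, which is the Krull dimension of the ring of polynomial functions
  on the simplex.

  Upper bound (\<open>prime_chain_length_le\<close>, for every subset of \<open>\<real>\<^sup>n\<close>). More than \<open>n\<close> polynomials in
  \<open>n\<close> variables satisfy a nontrivial polynomial relation: the number of monomials in these
  polynomials with exponents below \<open>K\<close> grows faster with \<open>K\<close> than the dimension of the space that
  contains them (\<open>polynomial_functions_algebraically_dependent\<close>). On the other hand, elements picked
  from the successive differences of a chain of primes satisfy no such relation
  (\<open>prime_chain_no_relation\<close>); this is one direction of the elementary characterisation of Krull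
  dimension by Coquand and Lombardi. It replaces integral extensions and Noether normalisation.

  Lower bound (\<open>prime_chain_std_simplex\<close>). The functions that vanish on a nonempty convex set form a
  prime ideal, since on a segment a polynomial is a polynomial in one variable. The flag of faces of
  the simplex cut out by more and more equations \<open>x\<^sub>i = 0\<close> gives a chain of \<open>n + 1\<close> such primes.
\<close>

section \<open>Algebraic dependence of polynomial functions\<close>

text \<open>
  Gaussian elimination: a pivot removes one equation and one unknown at a time. The system is
  indexed by sets, since the numbers of unknowns and equations will depend on a degree bound.
\<close>

lemma homogeneous_system_nontrivial_solution:
  fixes c :: "'i \<Rightarrow> 'j \<Rightarrow> real"
  assumes "finite J" "finite I" "card J < card I"
  shows "\<exists>v. (\<exists>i\<in>I. v i \<noteq> 0) \<and> (\<forall>j\<in>J. (\<Sum>i\<in>I. v i * c i j) = 0)"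
  using assms
proof (induction J arbitrary: I c rule: finite_induct)
  case empty
  then have "I \<noteq> {}" by auto
  then show ?case by (auto intro!: exI[of _ "\<lambda>_. 1"])
next
  case (insert j J)
  show ?case
  proof (cases "\<forall>i\<in>I. c i j = 0")
    case True
    have "card J < card I" using insert by simp
    from insert.IH[OF insert.prems(1) this, of c] True show ?thesis by auto
  next
    case False
    then obtain p where p: "p \<in> I" "c p j \<noteq> 0" by auto
    let ?I = "I - {p}"
    have "card J < card ?I" "finite ?I" using insert p by auto
    from insert.IH[OF this(2,1), of "\<lambda>i k. c i k - c i j / c p j * c p k"]
    obtain v where v: "\<exists>i\<in>?I. v i \<noteq> 0"
      "\<And>k. k \<in> J \<Longrightarrow> (\<Sum>i\<in>?I. v i * (c i k - c i j / c p j * c p k)) = 0" by blast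
    define q where "q = - (\<Sum>i\<in>?I. v i * c i j) / c p j"
    define w where "w = v(p := q)"
    have sum_w: "(\<Sum>i\<in>I. w i * c i k) = q * c p k + (\<Sum>i\<in>?I. v i * c i k)" for k
      using insert.prems(1) p(1) by (simp add: sum.remove w_def)
    have "(\<Sum>i\<in>I. w i * c i k) = 0" if "k \<in> insert j J" for k
    proof (cases "k = j")
      case True
      then show ?thesis using p by (simp add: sum_w q_def)
    next
      case False
      then have "0 = (\<Sum>i\<in>?I. v i * (c i k - c i j / c p j * c p k))" using v(2) that by simp
      also have "\<dots> = (\<Sum>i\<in>?I. v i * c i k) + q * c p k"
        by (simp add: q_def right_diff_distrib sum_subtractf sum_divide_distrib sum_distrib_right
            mult.assoc)
      finally show ?thesis by (simp add: sum_w)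
    qed
    moreover have "\<exists>i\<in>I. w i \<noteq> 0" using v(1) by (auto simp: w_def)
    ultimately show ?thesis by blast
  qed
qed

text \<open>
  Bounding each exponent separately, rather than the total degree, makes the number of monomials
  a plain power.
\<close>

definition exponent_box :: "nat \<Rightarrow> ('n::finite \<Rightarrow> nat) set" where
  "exponent_box d = {\<alpha>. \<forall>i. \<alpha> i \<le> d}"

lemma exponent_box_eq_PiE: "exponent_box d = (UNIV :: 'n::finite set) \<rightarrow>\<^sub>E {..d}"
  by (auto simp: exponent_box_def PiE_def Pi_def)

lemma finite_exponent_box: "finite (exponent_box d :: ('n::finite \<Rightarrow> nat) set)"
  unfolding exponent_box_eq_PiE by (rule finite_PiE) auto

lemma card_exponent_box: "card (exponent_box d :: ('n::finite \<Rightarrow> nat) set) = Suc d ^ CARD('n)"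
  unfolding exponent_box_eq_PiE by (subst card_PiE) auto

definition monomial :: "('n::finite \<Rightarrow> nat) \<Rightarrow> real ^ 'n \<Rightarrow> real" where
  "monomial \<alpha> x = (\<Prod>j\<in>UNIV. x $ j ^ \<alpha> j)"

definition box_span :: "nat \<Rightarrow> (real ^ 'n::finite \<Rightarrow> real) \<Rightarrow> bool" where
  "box_span d f \<longleftrightarrow> (\<exists>c. \<forall>x. f x = (\<Sum>\<alpha>\<in>exponent_box d. c \<alpha> * monomial \<alpha> x))"

lemma box_span_monomial: "\<alpha> \<in> exponent_box d \<Longrightarrow> box_span d (\<lambda>x. a * monomial \<alpha> x)"
  unfolding box_span_def
  by (rule exI[of _ "\<lambda>\<beta>. if \<beta> = \<alpha> then a else 0"])
    (simp add: if_distrib[of "\<lambda>u. u * _"] finite_exponent_box cong: if_cong)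

lemma box_span_add:
  assumes "box_span d f" "box_span d g"
  shows "box_span d (\<lambda>x. f x + g x)"
proof -
  obtain a b where "\<And>x. f x = (\<Sum>\<alpha>\<in>exponent_box d. a \<alpha> * monomial \<alpha> x)"
    "\<And>x. g x = (\<Sum>\<alpha>\<in>exponent_box d. b \<alpha> * monomial \<alpha> x)"
    using assms unfolding box_span_def by auto
  then show ?thesis unfolding box_span_def
    by (intro exI[of _ "\<lambda>\<alpha>. a \<alpha> + b \<alpha>"]) (simp add: sum.distrib algebra_simps)
qed

lemma box_span_sum:
  assumes "finite A" "\<And>i. i \<in> A \<Longrightarrow> box_span d (f i)"
  shows "box_span d (\<lambda>x. \<Sum>i\<in>A. f i x)"
  using assms
proof (induction A)
  case empty
  show ?case by (auto simp: box_span_def intro!: exI[of _ "\<lambda>_. 0"])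
next
  case (insert i A)
  then show ?case by (simp add: box_span_add)
qed

lemma box_span_mono:
  assumes "box_span d f" "d \<le> e"
  shows "box_span e f"
proof -
  obtain c where c: "\<And>x. f x = (\<Sum>\<alpha>\<in>exponent_box d. c \<alpha> * monomial \<alpha> x)"
    using assms unfolding box_span_def by auto
  have "box_span e (\<lambda>x. \<Sum>\<alpha>\<in>exponent_box d. c \<alpha> * monomial \<alpha> x)"
    using assms(2)
    by (intro box_span_sum box_span_monomial finite_exponent_box)
      (auto simp: exponent_box_def intro: order_trans)
  then show ?thesis by (simp flip: c)
qed

lemma box_span_mult:
  assumes "box_span d f" "box_span e g"
  shows "box_span (d + e) (\<lambda>x. f x * g x)"
proof -
  obtain a b where f: "\<And>x. f x = (\<Sum>\<alpha>\<in>exponent_box d. a \<alpha> * monomial \<alpha> x)"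
    and g: "\<And>x. g x = (\<Sum>\<beta>\<in>exponent_box e. b \<beta> * monomial \<beta> x)"
    using assms unfolding box_span_def by auto
  have "f x * g x = (\<Sum>\<alpha>\<in>exponent_box d. \<Sum>\<beta>\<in>exponent_box e.
      (a \<alpha> * b \<beta>) * monomial (\<lambda>i. \<alpha> i + \<beta> i) x)" for x
    unfolding f g sum_product
    by (simp add: monomial_def power_add prod.distrib mult_ac)
  moreover have "box_span (d + e) (\<lambda>x. \<Sum>\<alpha>\<in>exponent_box d. \<Sum>\<beta>\<in>exponent_box e.
      (a \<alpha> * b \<beta>) * monomial (\<lambda>i. \<alpha> i + \<beta> i) x)"
    by (intro box_span_sum box_span_monomial finite_exponent_box)
      (auto simp: exponent_box_def intro: add_mono)
  ultimately show ?thesis by simp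
qed

lemma box_span_const: "box_span d (\<lambda>_. a)"
  using box_span_monomial[of "\<lambda>_. 0" d a] by (simp add: exponent_box_def monomial_def)

lemma box_span_power: "box_span d f \<Longrightarrow> box_span (k * d) (\<lambda>x. f x ^ k)"
  by (induction k) (auto simp: box_span_const intro: box_span_mult)

lemma real_polynomial_function_box_span:
  fixes f :: "real ^ 'n::finite \<Rightarrow> real"
  assumes "real_polynomial_function f"
  shows "\<exists>d. box_span d f"
  using assms
proof (induction f)
  case (linear f)
  then interpret bounded_linear f .
  have "f x = (\<Sum>j\<in>UNIV. f (axis j 1) * monomial (\<lambda>i. if i = j then 1 else 0) x)" for x
  proof -
    have "f x = f (\<Sum>j\<in>UNIV. x $ j *\<^sub>R axis j 1)"
      by (simp add: basis_expansion scalar_mult_eq_scaleR[symmetric])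
    also have "\<dots> = (\<Sum>j\<in>UNIV. f (axis j 1) * x $ j)"
      by (simp add: sum scaleR mult.commute)
    finally show ?thesis
      by (simp add: monomial_def if_distrib[of "\<lambda>k. _ ^ k"] cong: if_cong)
  qed
  moreover have "box_span 1 (\<lambda>x. \<Sum>j\<in>UNIV. f (axis j 1) * monomial (\<lambda>i. if i = j then 1 else 0) x)"
    by (intro box_span_sum box_span_monomial) (auto simp: exponent_box_def)
  ultimately show ?case by (metis (no_types, lifting) ext)
next
  case (const c)
  show ?case using box_span_const by blast
next
  case (add f g)
  then obtain d e where "box_span d f" "box_span e g" by auto
  then have "box_span (max d e) f" "box_span (max d e) g" by (auto intro: box_span_mono)
  then show ?case using box_span_add by blast
next
  case (mult f g)
  then show ?case using box_span_mult by blast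
qed

text \<open>
  The monomials in given functions \<open>fs\<close>. Lists serve as exponent vectors here so that the first
  function can be split off in an induction.
\<close>

definition power_product :: "('a \<Rightarrow> real) list \<Rightarrow> nat list \<Rightarrow> 'a \<Rightarrow> real" where
  "power_product fs ks x = prod_list (map2 (\<lambda>f k. f x ^ k) fs ks)"

definition exponent_lists :: "nat \<Rightarrow> nat \<Rightarrow> nat list set" where
  "exponent_lists K N = {ks. set ks \<subseteq> {..<K} \<and> length ks = N}"

lemma power_product_Nil [simp]: "power_product [] ks x = 1"
  by (simp add: power_product_def)

lemma power_product_Cons [simp]:
  "power_product (f # fs) (k # ks) x = f x ^ k * power_product fs ks x"
  by (simp add: power_product_def)

lemma finite_exponent_lists: "finite (exponent_lists K N)"
  unfolding exponent_lists_def by (rule finite_lists_length_eq) simp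

lemma card_exponent_lists: "card (exponent_lists K N) = K ^ N"
  unfolding exponent_lists_def by (subst card_lists_length_eq) auto

lemma exponent_lists_0 [simp]: "exponent_lists K 0 = {[]}"
  by (auto simp: exponent_lists_def)

lemma exponent_lists_Suc:
  "exponent_lists K (Suc N) = (\<lambda>(k, ks). k # ks) ` ({..<K} \<times> exponent_lists K N)"
  by (auto simp: exponent_lists_def length_Suc_conv)

lemma sum_exponent_lists_Suc:
  "sum g (exponent_lists K (Suc N)) = (\<Sum>k<K. \<Sum>ks\<in>exponent_lists K N. g (k # ks))"
  unfolding exponent_lists_Suc
  by (subst sum.reindex) (auto simp: inj_on_def sum.cartesian_product intro!: sum.cong)

lemma box_span_power_product:
  assumes "\<And>f. f \<in> set fs \<Longrightarrow> box_span d f" "ks \<in> exponent_lists K (length fs)"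
  shows "box_span (length fs * (K * d)) (power_product fs ks)"
  using assms
proof (induction fs arbitrary: ks)
  case Nil
  then show ?case using box_span_const[of 0 1] by (simp add: power_product_def[abs_def])
next
  case (Cons f fs)
  then obtain k ls where ks: "ks = k # ls" "k < K" "ls \<in> exponent_lists K (length fs)"
    by (auto simp: exponent_lists_Suc)
  have "box_span (k * d) (\<lambda>x. f x ^ k)" using Cons.prems by (intro box_span_power) simp
  then have "box_span (K * d) (\<lambda>x. f x ^ k)"
    by (rule box_span_mono) (use ks in simp)
  moreover have "box_span (length fs * (K * d)) (power_product fs ls)"
    using Cons ks by simp
  ultimately have "box_span (K * d + length fs * (K * d)) (\<lambda>x. f x ^ k * power_product fs ls x)"
    by (rule box_span_mult)
  moreover have "power_product (f # fs) ks = (\<lambda>x. f x ^ k * power_product fs ls x)"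
    by (simp add: ks fun_eq_iff)
  ultimately show ?case by simp
qed

text \<open>
  A dimension count. The \<open>K\<^sup>N\<close> power products of \<open>N > n\<close> polynomials with exponents below \<open>K\<close>
  lie in a space of dimension at most \<open>(N K d + 1)\<^sup>n\<close>, where \<open>d\<close> bounds the exponents of the
  given polynomials. The latter is of order \<open>K\<^sup>n\<close>, so for large \<open>K\<close> there is a linear relation.
\<close>

lemma polynomial_functions_algebraically_dependent:
  fixes fs :: "(real ^ 'n::finite \<Rightarrow> real) list"
  assumes poly: "\<And>f. f \<in> set fs \<Longrightarrow> real_polynomial_function f"
    and len: "CARD('n) < length fs"
  shows "\<exists>K v. (\<exists>ks\<in>exponent_lists K (length fs). v ks \<noteq> 0) \<and>
    (\<forall>x. (\<Sum>ks\<in>exponent_lists K (length fs). v ks * power_product fs ks x) = 0)"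
proof -
  let ?n = "CARD('n)" and ?N = "length fs"
  obtain deg where deg: "\<And>f. f \<in> set fs \<Longrightarrow> box_span (deg f) f"
    using real_polynomial_function_box_span poly by metis
  define d where "d = Max (insert 0 (deg ` set fs))"
  have d: "box_span d f" if "f \<in> set fs" for f
    using deg[OF that] that by (auto simp: d_def intro!: box_span_mono[OF deg])
  \<comment> \<open>The dimension is at most \<open>K ^ n * (N * d + 1) ^ n\<close>; this \<open>K\<close> exceeds the second factor.\<close>
  define K where "K = Suc (Suc (?N * d) ^ ?n)"
  define D where "D = ?N * (K * d)"
  let ?L = "exponent_lists K ?N"
  let ?B = "exponent_box D :: ('n \<Rightarrow> nat) set"
  have "Suc D \<le> K * Suc (?N * d)" by (simp add: D_def K_def algebra_simps)
  then have "card ?B \<le> (K * Suc (?N * d)) ^ ?n"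
    unfolding card_exponent_box by (rule power_mono) simp
  also have "\<dots> = K ^ ?n * Suc (?N * d) ^ ?n" by (rule power_mult_distrib)
  also have "\<dots> < K ^ ?n * K"
    by (rule mult_strict_left_mono) (auto simp: K_def)
  also have "\<dots> = K ^ Suc ?n" by simp
  also have "\<dots> \<le> K ^ ?N" using len by (intro power_increasing) (auto simp: K_def)
  also have "\<dots> = card ?L" by (simp add: card_exponent_lists)
  finally have card: "card ?B < card ?L" .
  have "\<forall>ks\<in>?L. \<exists>c. \<forall>x. power_product fs ks x = (\<Sum>\<alpha>\<in>?B. c \<alpha> * monomial \<alpha> x)"
    using box_span_power_product[of fs d _ K] d unfolding box_span_def D_def by blast
  then obtain c where c: "\<And>ks x. ks \<in> ?L \<Longrightarrow>
      power_product fs ks x = (\<Sum>\<alpha>\<in>?B. c ks \<alpha> * monomial \<alpha> x)"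
    by metis
  obtain v where v: "\<exists>ks\<in>?L. v ks \<noteq> 0" "\<And>\<alpha>. \<alpha> \<in> ?B \<Longrightarrow> (\<Sum>ks\<in>?L. v ks * c ks \<alpha>) = 0"
    using homogeneous_system_nontrivial_solution[OF finite_exponent_box finite_exponent_lists card, of c]
    by blast
  have "(\<Sum>ks\<in>?L. v ks * power_product fs ks x) = 0" for x
  proof -
    have "(\<Sum>ks\<in>?L. v ks * power_product fs ks x)
        = (\<Sum>ks\<in>?L. \<Sum>\<alpha>\<in>?B. v ks * c ks \<alpha> * monomial \<alpha> x)"
      by (simp add: c sum_distrib_left mult.assoc)
    also have "\<dots> = (\<Sum>\<alpha>\<in>?B. (\<Sum>ks\<in>?L. v ks * c ks \<alpha>) * monomial \<alpha> x)"
      by (subst sum.swap) (simp add: sum_distrib_right)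
    also have "\<dots> = 0" by (simp add: v(2))
    finally show ?thesis .
  qed
  with v(1) show ?thesis by blast
qed

section \<open>Krull dimension of rings of polynomial functions\<close>

text \<open>
  Prime ideals of the full ring of polynomial functions, stated for functions directly. Primes of
  the ring of a subset \<open>S\<close> are pulled back to this ring, where polynomials need no restriction.
\<close>

definition prime_poly_ideal :: "(real ^ 'n::finite \<Rightarrow> real) set \<Rightarrow> bool" where
  "prime_poly_ideal Q \<longleftrightarrow>
     (\<forall>f\<in>Q. real_polynomial_function f) \<and>
     (\<lambda>_. 0) \<in> Q \<and> (\<lambda>_. 1) \<notin> Q \<and>
     (\<forall>f\<in>Q. \<forall>g\<in>Q. (\<lambda>x. f x + g x) \<in> Q) \<and>
     (\<forall>f\<in>Q. \<forall>g. real_polynomial_function g \<longrightarrow> (\<lambda>x. g x * f x) \<in> Q) \<and>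
     (\<forall>f g. real_polynomial_function f \<longrightarrow> real_polynomial_function g \<longrightarrow>
        (\<lambda>x. f x * g x) \<in> Q \<longrightarrow> f \<in> Q \<or> g \<in> Q)"

lemma
  assumes "prime_poly_ideal Q"
  shows prime_poly_ideal_polynomial: "f \<in> Q \<Longrightarrow> real_polynomial_function f"
    and prime_poly_ideal_one: "(\<lambda>_. 1) \<notin> Q"
    and prime_poly_ideal_add: "f \<in> Q \<Longrightarrow> g \<in> Q \<Longrightarrow> (\<lambda>x. f x + g x) \<in> Q"
    and prime_poly_ideal_absorb:
      "f \<in> Q \<Longrightarrow> real_polynomial_function g \<Longrightarrow> (\<lambda>x. g x * f x) \<in> Q"
    and prime_poly_ideal_prime:
      "real_polynomial_function f \<Longrightarrow> real_polynomial_function g \<Longrightarrow>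
        (\<lambda>x. f x * g x) \<in> Q \<Longrightarrow> f \<in> Q \<or> g \<in> Q"
  using assms by (simp_all add: prime_poly_ideal_def)

lemma real_polynomial_function_power_product:
  assumes "\<And>f. f \<in> set fs \<Longrightarrow> real_polynomial_function f"
  shows "real_polynomial_function (power_product fs ks)"
  using assms
proof (induction fs arbitrary: ks)
  case Nil
  then show ?case
    by (simp add: power_product_def[abs_def] real_polynomial_function.intros(2))
next
  case (Cons f fs)
  show ?case
  proof (cases ks)
    case Nil
    then show ?thesis
      by (simp add: power_product_def[abs_def] real_polynomial_function.intros(2))
  next
    case (Cons k ls)
    have "power_product (f # fs) ks = (\<lambda>x. f x ^ k * power_product fs ls x)"
      by (simp add: Cons fun_eq_iff)
    then show ?thesis using Cons.IH Cons.prems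
      by (auto intro!: real_polynomial_function.intros(4) real_polynomial_function_power)
  qed
qed

lemma prime_poly_ideal_power:
  assumes Q: "prime_poly_ideal Q" and "real_polynomial_function f" "real_polynomial_function g"
    and "f \<notin> Q" "(\<lambda>x. f x ^ k * g x) \<in> Q"
  shows "g \<in> Q"
  using assms(5)
proof (induction k)
  case (Suc k)
  have "real_polynomial_function (\<lambda>x. f x ^ k * g x)"
    using assms(2,3) by (intro real_polynomial_function.intros(4) real_polynomial_function_power)
  then have "(\<lambda>x. f x ^ k * g x) \<in> Q"
    using prime_poly_ideal_prime[OF Q assms(2), of "\<lambda>x. f x ^ k * g x"] Suc.prems assms(4)
    by (simp add: mult.assoc)
  then show ?case by (rule Suc.IH)
qed simp

text \<open>
  Suppose a relation in the functions \<open>f\<^sub>0, f\<^sub>1, \<dots>\<close> holds modulo the first prime \<open>Q\<^sub>0\<close>. Order it by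
  powers of \<open>f\<^sub>0\<close> and divide by the lowest power that occurs, which is possible since \<open>f\<^sub>0 \<notin> Q\<^sub>0\<close>
  and \<open>Q\<^sub>0\<close> is prime. As \<open>f\<^sub>0 \<in> Q\<^sub>1\<close>, the lowest coefficient is a nontrivial relation in
  \<open>f\<^sub>1, f\<^sub>2, \<dots>\<close> modulo \<open>Q\<^sub>1\<close>. Repeating this leaves a nonzero constant in the last prime.
\<close>

lemma prime_chain_no_relation:
  assumes "\<And>i. i \<le> length fs \<Longrightarrow> prime_poly_ideal (Q i)"
    and "\<And>i. i < length fs \<Longrightarrow> Q i \<subseteq> Q (Suc i)"
    and "\<And>i. i < length fs \<Longrightarrow> fs ! i \<in> Q (Suc i) - Q i"
    and "\<exists>ks\<in>exponent_lists K (length fs). v ks \<noteq> 0"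
  shows "(\<lambda>x. \<Sum>ks\<in>exponent_lists K (length fs). v ks * power_product fs ks x) \<notin> Q 0"
  using assms
proof (induction fs arbitrary: Q v)
  case Nil
  have Q: "prime_poly_ideal (Q 0)" using Nil(1) by simp
  have nz: "v [] \<noteq> 0" using Nil by simp
  show ?case
  proof
    assume "(\<lambda>x. \<Sum>ks\<in>exponent_lists K (length []). v ks * power_product [] ks x) \<in> Q 0"
    then have "(\<lambda>x. v []) \<in> Q 0" by simp
    then have "(\<lambda>x. (1 / v []) * v []) \<in> Q 0"
      by (rule prime_poly_ideal_absorb[OF Q]) (rule real_polynomial_function.intros(2))
    then show False using nz prime_poly_ideal_one[OF Q] by simp
  qed
next
  case (Cons f fs)
  let ?L = "exponent_lists K (length fs)"
  have prime: "prime_poly_ideal (Q i)" if "i \<le> Suc (length fs)" for i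
    using Cons.prems(1) that by simp
  then have prime_1: "prime_poly_ideal (Q 1)" by simp
  have f: "f \<in> Q 1" "f \<notin> Q 0" using Cons.prems(3)[of 0] by auto
  have poly_f: "real_polynomial_function f" using f prime_poly_ideal_polynomial[OF prime_1] by simp
  have poly_fs: "real_polynomial_function g" if g: "g \<in> set fs" for g
  proof -
    obtain i where "i < length fs" "g = fs ! i" using g by (metis in_set_conv_nth)
    then show ?thesis using Cons.prems(3)[of "Suc i"] prime[of "Suc (Suc i)"]
      by (auto intro: prime_poly_ideal_polynomial)
  qed
  \<comment> \<open>The coefficient of \<open>f ^ k\<close>, a polynomial in the remaining functions.\<close>
  define s where "s k = (\<lambda>x. \<Sum>ks\<in>?L. v (k # ks) * power_product fs ks x)" for k
  have poly_s: "real_polynomial_function (s k)" for k unfolding s_def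
    by (intro real_polynomial_function_sum finite_exponent_lists real_polynomial_function.intros(4)
        real_polynomial_function.intros(2) real_polynomial_function_power_product poly_fs)
  define m where "m = (LEAST k. k < K \<and> (\<exists>ks\<in>?L. v (k # ks) \<noteq> 0))"
  have ex: "\<exists>k. k < K \<and> (\<exists>ks\<in>?L. v (k # ks) \<noteq> 0)"
    using Cons.prems(4) by (auto simp: exponent_lists_Suc)
  have m: "m < K" "\<exists>ks\<in>?L. v (m # ks) \<noteq> 0" using LeastI_ex[OF ex] by (auto simp: m_def)
  have less: "s k = (\<lambda>_. 0)" if "k < m" for k
    using not_less_Least[of k "\<lambda>k. k < K \<and> (\<exists>ks\<in>?L. v (k # ks) \<noteq> 0)"] that m(1)
    by (auto simp: s_def m_def[symmetric] fun_eq_iff)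
  \<comment> \<open>All terms above the lowest one, divided by \<open>f ^ Suc m\<close>.\<close>
  define r where "r x = (\<Sum>k\<in>{Suc m..<K}. f x ^ (k - Suc m) * s k x)" for x
  have poly_r: "real_polynomial_function r" unfolding r_def
    by (intro real_polynomial_function_sum real_polynomial_function.intros(4) poly_s
        real_polynomial_function_power poly_f) simp
  have split: "(\<Sum>ks\<in>exponent_lists K (length (f # fs)). v ks * power_product (f # fs) ks x)
      = f x ^ m * (s m x + r x * f x)" for x
  proof -
    have "(\<Sum>ks\<in>exponent_lists K (length (f # fs)). v ks * power_product (f # fs) ks x)
        = (\<Sum>k<K. f x ^ k * s k x)"
      by (simp add: sum_exponent_lists_Suc s_def sum_distrib_left mult_ac)
    also have "\<dots> = (\<Sum>k\<in>{m..<K}. f x ^ k * s k x)"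
      by (rule sum.mono_neutral_right) (auto simp: less)
    also have "\<dots> = f x ^ m * s m x + (\<Sum>k\<in>{Suc m..<K}. f x ^ k * s k x)"
      by (simp add: sum.atLeast_Suc_lessThan m(1))
    also have "(\<Sum>k\<in>{Suc m..<K}. f x ^ k * s k x)
        = (\<Sum>k\<in>{Suc m..<K}. f x ^ m * f x * (f x ^ (k - Suc m) * s k x))"
    proof (rule sum.cong)
      fix k assume "k \<in> {Suc m..<K}"
      then have "k = m + 1 + (k - Suc m)" by simp
      then have "f x ^ k = f x ^ m * f x * f x ^ (k - Suc m)" by (metis power_add power_one_right)
      then show "f x ^ k * s k x = f x ^ m * f x * (f x ^ (k - Suc m) * s k x)" by simp
    qed simp
    also have "\<dots> = f x ^ m * (r x * f x)"
      by (simp add: r_def sum_distrib_left sum_distrib_right mult_ac)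
    finally show ?thesis by (simp add: algebra_simps)
  qed
  have "s m \<notin> Q 1"
    using Cons.IH[of "\<lambda>i. Q (Suc i)" "\<lambda>ks. v (m # ks)"] m(2) Cons.prems(1-3)[of "Suc _"]
    unfolding s_def by fastforce
  show ?case
  proof
    assume "(\<lambda>x. \<Sum>ks\<in>exponent_lists K (length (f # fs)). v ks * power_product (f # fs) ks x) \<in> Q 0"
    then have "(\<lambda>x. f x ^ m * (s m x + r x * f x)) \<in> Q 0" by (simp only: split)
    then have "(\<lambda>x. s m x + r x * f x) \<in> Q 0"
      by (rule prime_poly_ideal_power[rotated 4])
        (auto intro!: prime poly_f f real_polynomial_function.intros(3) real_polynomial_function.intros(4)
          poly_s poly_r)
    then have sum_in: "(\<lambda>x. s m x + r x * f x) \<in> Q 1" using Cons.prems(2)[of 0] by auto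
    have "real_polynomial_function (\<lambda>x. - r x)"
      using poly_r by (rule real_polynomial_function_minus)
    then have "(\<lambda>x. - r x * f x) \<in> Q 1"
      using prime_poly_ideal_absorb[OF prime_1 f(1)] by blast
    then have "(\<lambda>x. (s m x + r x * f x) + (- r x * f x)) \<in> Q 1"
      using prime_poly_ideal_add[OF prime_1 sum_in] by blast
    then show False using \<open>s m \<notin> Q 1\<close> by simp
  qed
qed

lemma prime_poly_ideal_preimage:
  assumes "primeideal P (poly_fun_ring S)"
  shows "prime_poly_ideal {f. real_polynomial_function f \<and> restrict f S \<in> P}"
proof -
  interpret primeideal P "poly_fun_ring S" by fact
  have carrier: "restrict f S \<in> carrier (poly_fun_ring S)" if "real_polynomial_function f" for f
    using that by (auto simp: poly_fun_ring_def)
  have add: "restrict f S \<oplus>\<^bsub>poly_fun_ring S\<^esub> restrict g S = restrict (\<lambda>x. f x + g x) S"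
    and mult: "restrict f S \<otimes>\<^bsub>poly_fun_ring S\<^esub> restrict g S = restrict (\<lambda>x. f x * g x) S" for f g
    by (auto simp: poly_fun_ring_def fun_eq_iff)
  have "restrict (\<lambda>_. 0) S \<in> P" using additive_subgroup.zero_closed[OF is_additive_subgroup]
    by (simp add: poly_fun_ring_def)
  moreover have "\<one>\<^bsub>poly_fun_ring S\<^esub> \<notin> P" using one_imp_carrier I_notcarr by metis
  then have "restrict (\<lambda>_. 1) S \<notin> P" by (simp add: poly_fun_ring_def)
  moreover have "restrict (\<lambda>x. f x + g x) S \<in> P" if "restrict f S \<in> P" "restrict g S \<in> P" for f g
    using additive_subgroup.a_closed[OF is_additive_subgroup that] by (simp add: add)
  moreover have "restrict (\<lambda>x. g x * f x) S \<in> P"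
    if "restrict f S \<in> P" "real_polynomial_function g" for f g
    using I_l_closed[OF that(1) carrier[OF that(2)]] by (simp add: mult)
  moreover have "restrict f S \<in> P \<or> restrict g S \<in> P"
    if "real_polynomial_function f" "real_polynomial_function g" "restrict (\<lambda>x. f x * g x) S \<in> P"
    for f g
    using I_prime[OF carrier[OF that(1)] carrier[OF that(2)]] that(3) by (simp add: mult)
  ultimately show ?thesis
    unfolding prime_poly_ideal_def
    by (auto intro: real_polynomial_function.intros)
qed

lemma prime_chain_length_le:
  fixes S :: "(real ^ 'n::finite) set"
  assumes P: "\<And>i. i \<le> k \<Longrightarrow> primeideal (P i) (poly_fun_ring S)"
    and chain: "\<And>i. i < k \<Longrightarrow> P i \<subset> P (Suc i)"
  shows "k \<le> CARD('n)"
proof (rule ccontr)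
  assume "\<not> k \<le> CARD('n)"
  define Q where "Q i = {f. real_polynomial_function f \<and> restrict f S \<in> P i}" for i
  have prime: "prime_poly_ideal (Q i)" if "i \<le> k" for i
    unfolding Q_def by (rule prime_poly_ideal_preimage[OF P[OF that]])
  have sub: "Q i \<subseteq> Q (Suc i)" if "i < k" for i
    using chain[OF that] by (auto simp: Q_def)
  have "\<exists>f. f \<in> Q (Suc i) - Q i" if i: "i < k" for i
  proof -
    obtain h where h: "h \<in> P (Suc i)" "h \<notin> P i" using chain[OF i] by auto
    have "primeideal (P (Suc i)) (poly_fun_ring S)" using P i by simp
    then have "h \<in> carrier (poly_fun_ring S)"
      using h(1) additive_subgroup.a_subset ideal.axioms(1) primeideal.axioms(1) by blast
    then obtain f where "real_polynomial_function f" "h = restrict f S"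
      by (auto simp: poly_fun_ring_def)
    then show ?thesis using h by (auto simp: Q_def)
  qed
  then obtain F where F: "\<And>i. i < k \<Longrightarrow> F i \<in> Q (Suc i) - Q i" by metis
  define fs where "fs = map F [0..<k]"
  have "real_polynomial_function f" if "f \<in> set fs" for f
    using that F by (auto simp: fs_def Q_def)
  moreover have "CARD('n) < length fs" using \<open>\<not> k \<le> CARD('n)\<close> by (simp add: fs_def)
  ultimately obtain K v where v: "\<exists>ks\<in>exponent_lists K (length fs). v ks \<noteq> 0"
    "\<And>x. (\<Sum>ks\<in>exponent_lists K (length fs). v ks * power_product fs ks x) = 0"
    using polynomial_functions_algebraically_dependent by blast
  have "(\<lambda>x. \<Sum>ks\<in>exponent_lists K (length fs). v ks * power_product fs ks x) \<notin> Q 0"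
    by (rule prime_chain_no_relation) (use prime sub F v(1) in \<open>auto simp: fs_def\<close>)
  then show False using prime[of 0] by (simp add: v(2) prime_poly_ideal_def)
qed

text \<open>
  If \<open>f a\<close> and \<open>g b\<close> were both nonzero, then \<open>f\<close> and \<open>g\<close> would each have finitely many zeros
  on the segment from \<open>a\<close> to \<open>b\<close>, which cannot cover the segment.
\<close>

lemma polynomial_product_zero_on_convex:
  fixes f g :: "'a::euclidean_space \<Rightarrow> real"
  assumes f: "real_polynomial_function f" and g: "real_polynomial_function g"
    and C: "convex C" and zero: "\<And>x. x \<in> C \<Longrightarrow> f x * g x = 0"
    and a: "a \<in> C" "f a \<noteq> 0" and b: "b \<in> C"
  shows "g b = 0"
proof (rule ccontr)
  assume nz: "g b \<noteq> 0"
  define l where "l t = a + t *\<^sub>R (b - a)" for t :: real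
  have lin: "polynomial_function l" unfolding l_def
    by (intro polynomial_function_add polynomial_function_const polynomial_function_bounded_linear
        bounded_linear_scaleR_left)
  have finite_zeros: "finite {t. h (l t) = 0}" if "real_polynomial_function h" "h (l u) \<noteq> 0" for h u
  proof -
    have "real_polynomial_function (h \<circ> l)"
      using lin that(1) by (rule real_polynomial_function_compose)
    then obtain c n where c: "h \<circ> l = (\<lambda>t. \<Sum>i\<le>n. c i * t ^ i)"
      by (auto simp: real_polynomial_function_iff_sum)
    then have eq: "h (l t) = (\<Sum>i\<le>n. c i * t ^ i)" for t by (metis comp_apply)
    have "\<exists>i\<le>n. c i \<noteq> 0"
    proof (rule ccontr)
      assume "\<not> (\<exists>i\<le>n. c i \<noteq> 0)"
      then have "h (l u) = 0" by (simp add: eq)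
      with that(2) show False by contradiction
    qed
    then show ?thesis unfolding eq by (simp add: polyfun_finite_roots)
  qed
  have "l t \<in> C" if "t \<in> {0..1}" for t
    using convexD_alt[OF C a(1) b, of t] that by (simp add: l_def algebra_simps)
  then have "{0..1} \<subseteq> {t. f (l t) = 0} \<union> {t. g (l t) = 0}" using zero by fastforce
  moreover have "finite {t. f (l t) = 0}" "finite {t. g (l t) = 0}"
    using finite_zeros[OF f, of 0] finite_zeros[OF g, of 1] a nz by (auto simp: l_def)
  ultimately have "finite {0..1::real}" by (meson finite_UnI finite_subset)
  then show False by (simp add: infinite_Icc)
qed

definition vanishing_ideal :: "(real ^ 'n) set \<Rightarrow> (real ^ 'n) set \<Rightarrow> (real ^ 'n \<Rightarrow> real) set" where
  "vanishing_ideal S C = {h \<in> carrier (poly_fun_ring S). \<forall>x\<in>C. h x = 0}"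

lemma primeideal_vanishing_ideal_convex:
  fixes S C :: "(real ^ 'n::finite) set"
  assumes "convex C" "C \<noteq> {}" "C \<subseteq> S"
  shows "primeideal (vanishing_ideal S C) (poly_fun_ring S)"
proof (rule primeidealI)
  let ?R = "poly_fun_ring S" and ?I = "vanishing_ideal S C"
  show "cring ?R" by (rule cring_poly_fun_ring)
  then interpret cring ?R .
  have mult: "(f \<otimes>\<^bsub>?R\<^esub> g) x = f x * g x" and add: "(f \<oplus>\<^bsub>?R\<^esub> g) x = f x + g x" if "x \<in> C" for f g x
    using that assms(3) by (auto simp: poly_fun_ring_def)
  have zero: "\<zero>\<^bsub>?R\<^esub> x = 0" and one: "\<one>\<^bsub>?R\<^esub> x = 1" if "x \<in> C" for x
    using that assms(3) by (auto simp: poly_fun_ring_def)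
  have uminus: "(\<ominus>\<^bsub>?R\<^esub> f) x = - f x" if "x \<in> C" "f \<in> carrier ?R" for f x
    using add[OF that(1), of f "\<ominus>\<^bsub>?R\<^esub> f"] that by (simp add: r_neg zero)
  show "ideal ?I ?R"
  proof (rule idealI)
    show "ring ?R" by (rule ring_axioms)
    show "subgroup ?I (add_monoid ?R)"
    proof (rule add.subgroupI)
      have "\<zero>\<^bsub>?R\<^esub> \<in> ?I" using zero by (simp add: vanishing_ideal_def)
      then show "?I \<noteq> {}" by auto
    qed (auto simp: vanishing_ideal_def add uminus)
  qed (auto simp: vanishing_ideal_def mult)
  obtain p where "p \<in> C" using assms(2) by auto
  then have "\<one>\<^bsub>?R\<^esub> \<notin> ?I" using one[of p]
    by (auto simp: vanishing_ideal_def intro!: bexI[of _ p])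
  then show "carrier ?R \<noteq> ?I" using one_closed by metis
  show "a \<in> ?I \<or> b \<in> ?I"
    if ab: "a \<in> carrier ?R" "b \<in> carrier ?R" "a \<otimes>\<^bsub>?R\<^esub> b \<in> ?I" for a b
  proof -
    obtain f g where fg: "real_polynomial_function f" "real_polynomial_function g"
      "a = restrict f S" "b = restrict g S" using ab by (auto simp: poly_fun_ring_def)
    have val: "a x = f x" "b x = g x" if "x \<in> C" for x using that assms(3) fg by auto
    have "f x * g x = 0" if "x \<in> C" for x
      using ab(3) that by (auto simp: vanishing_ideal_def mult val)
    then show ?thesis
      using polynomial_product_zero_on_convex[OF fg(1,2) assms(1)] ab(1,2)
      by (auto simp: vanishing_ideal_def val)
  qed
qed

section \<open>The standard simplex\<close>

lemma convex_std_simplex: "convex std_simplex"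
  unfolding convex_alt
proof (clarify)
  fix x y :: "real ^ 'n" and u :: real
  assume xy: "x \<in> std_simplex" "y \<in> std_simplex" and u: "0 \<le> u" "u \<le> 1"
  have "(\<Sum>i\<in>UNIV. (1 - u) * x $ i + u * y $ i)
      = (1 - u) * (\<Sum>i\<in>UNIV. x $ i) + u * (\<Sum>i\<in>UNIV. y $ i)"
    by (simp add: sum.distrib sum_distrib_left)
  also have "\<dots> \<le> 1"
    using xy u by (intro convex_bound_le) (auto simp: std_simplex_def)
  finally show "(1 - u) *\<^sub>R x + u *\<^sub>R y \<in> std_simplex"
    using xy u by (auto simp: std_simplex_def)
qed

text \<open>
  The primes are the vanishing ideals of the faces on which the first \<open>i\<close> coordinates vanish, for
  \<open>i = 0, \<dots>, n\<close>. Each inclusion is strict because of the next coordinate function, which does not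
  vanish at the corresponding vertex.
\<close>

lemma prime_chain_std_simplex:
  "\<exists>P. (\<forall>i\<le>CARD('n). primeideal (P i) (poly_fun_ring (std_simplex :: (real ^ 'n::finite) set))) \<and>
     (\<forall>i<CARD('n). P i \<subset> P (Suc i))"
proof -
  obtain e where e: "bij_betw e {..<CARD('n)} (UNIV :: 'n set)"
    using ex_bij_betw_nat_finite[OF finite_class.finite_UNIV] by (auto simp: atLeast0LessThan)
  define C where "C i = {x \<in> std_simplex. \<forall>j<i. x $ e j = 0}" for i
  define P where "P i = vanishing_ideal std_simplex (C i)" for i
  have "convex {x :: real ^ 'n. \<forall>j<i. x $ e j = 0}" for i
    by (auto simp: convex_def)
  moreover have "C i = std_simplex \<inter> {x. \<forall>j<i. x $ e j = 0}" for i by (auto simp: C_def)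
  ultimately have "convex (C i)" for i by (simp add: convex_Int convex_std_simplex)
  moreover have "0 \<in> C i" for i by (auto simp: C_def std_simplex_def)
  ultimately have "primeideal (P i) (poly_fun_ring std_simplex)" for i unfolding P_def
    by (intro primeideal_vanishing_ideal_convex) (auto simp: C_def)
  moreover have "P i \<subset> P (Suc i)" if i: "i < CARD('n)" for i
  proof
    show "P i \<subseteq> P (Suc i)" by (auto simp: P_def C_def vanishing_ideal_def)
    let ?h = "restrict (\<lambda>x. x $ e i) std_simplex"
    have "?h \<in> P (Suc i)"
      by (auto simp: P_def vanishing_ideal_def C_def poly_fun_ring_def
          intro!: exI[of _ "\<lambda>x. x $ e i"] real_polynomial_function.intros(1) bounded_linear_vec_nth)
    moreover have "e j \<noteq> e i" if "j < i" for j
      using e i that by (auto simp: bij_betw_def inj_on_def)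
    then have "axis (e i) 1 \<in> C i"
      by (auto simp: C_def std_simplex_def axis_def)
    then have "?h \<notin> P i" by (force simp: P_def vanishing_ideal_def C_def)
    ultimately show "P i \<noteq> P (Suc i)" by auto
  qed
  ultimately show ?thesis by blast
qed

lemma semialgebraic_dim_std_simplex:
  "semialgebraic_dim (std_simplex :: (real ^ 'n::finite) set) = enat CARD('n)"
proof -
  define chain where "chain k \<longleftrightarrow> (\<exists>P. (\<forall>i\<le>k. primeideal (P i)
      (poly_fun_ring (std_simplex :: (real ^ 'n) set))) \<and> (\<forall>i<k. P i \<subset> P (Suc i)))" for k
  have "k \<le> CARD('n)" if "chain k" for k
  proof -
    from that[unfolded chain_def] obtain P where
      P: "(\<forall>i\<le>k. primeideal (P i) (poly_fun_ring (std_simplex :: (real ^ 'n) set))) \<and>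
        (\<forall>i<k. P i \<subset> P (Suc i))" ..
    show ?thesis by (rule prime_chain_length_le[of k P std_simplex]) (use P in simp_all)
  qed
  then have "Sup {enat k | k. chain k} \<le> enat CARD('n)"
    by (intro Sup_least) auto
  moreover have "chain CARD('n)"
    unfolding chain_def by (rule prime_chain_std_simplex)
  then have "enat CARD('n) \<le> Sup {enat k | k. chain k}"
    by (intro Sup_upper) blast
  moreover have "semialgebraic_dim (std_simplex :: (real ^ 'n) set) = Sup {enat k | k. chain k}"
    unfolding semialgebraic_dim_def krull_dim_def chain_def by (rule refl)
  ultimately show ?thesis by simp
qed

lemma semialgebraic_std_simplex: "semialgebraic (std_simplex :: (real ^ 'n::finite) set)"
proof -
  have nth: "real_polynomial_function (\<lambda>x :: real ^ 'n. x $ i)" for i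
    by (rule real_polynomial_function.intros(1)) (rule bounded_linear_vec_nth)
  have "semialgebraic (- {x :: real ^ 'n. - (x $ i) > 0})" for i
    by (intro semialgebraic_Compl semialgebraic_pos real_polynomial_function_minus nth)
  then have orthant: "semialgebraic {x :: real ^ 'n. 0 \<le> x $ i}" for i
    by (simp add: Compl_eq not_less)
  have "semialgebraic {x :: real ^ 'n. \<forall>i\<in>I. 0 \<le> x $ i}" for I
  proof (induction I rule: finite_induct[OF finite])
    case 1
    show ?case using semialgebraic_eq[OF real_polynomial_function.intros(2)[of 0]] by simp
  next
    case (2 i I)
    then show ?case using semialgebraic_Int[OF orthant[of i]] by (simp add: Collect_conj_eq)
  qed
  moreover have "semialgebraic (- {x :: real ^ 'n. (\<Sum>i\<in>UNIV. x $ i) - 1 > 0})"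
    using nth by (intro semialgebraic_Compl semialgebraic_pos real_polynomial_function_diff
        real_polynomial_function_sum real_polynomial_function.intros(2)) auto
  then have "semialgebraic {x :: real ^ 'n. (\<Sum>i\<in>UNIV. x $ i) \<le> 1}"
    by (simp add: Compl_eq not_less)
  ultimately have "semialgebraic ({x :: real ^ 'n. \<forall>i\<in>UNIV. 0 \<le> x $ i} \<inter> {x. (\<Sum>i\<in>UNIV. x $ i) \<le> 1})"
    by (intro semialgebraic_Int)
  then show ?thesis by (simp add: std_simplex_def Collect_conj_eq)
qed

lemma interior_std_simplexI:
  fixes y :: "real ^ 'n::finite"
  assumes "\<And>i. 0 < y $ i" "(\<Sum>i\<in>UNIV. y $ i) < 1"
  shows "y \<in> interior std_simplex"
proof -
  have "open ((\<Inter>i\<in>UNIV. {x :: real ^ 'n. 0 < x $ i}) \<inter> {x. (\<Sum>i\<in>UNIV. x $ i) < 1})"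
    by (intro open_Int open_INT ballI open_Collect_less continuous_intros) auto
  moreover have "(\<Inter>i\<in>UNIV. {x :: real ^ 'n. 0 < x $ i}) \<inter> {x. (\<Sum>i\<in>UNIV. x $ i) < 1} \<subseteq> std_simplex"
    by (auto simp: std_simplex_def less_imp_le)
  ultimately show ?thesis using assms by (intro interiorI) auto
qed

lemma sum_squares_le_one_iff:
  fixes x :: "real ^ 'n::finite"
  shows "x \<in> cball 0 1 \<longleftrightarrow> (\<Sum>i\<in>UNIV. (x $ i)\<^sup>2) \<le> 1"
  by (simp add: norm_vec_def L2_set_def)

text \<open>
  The homotopy: the squaring map, contracted linearly to the barycentre of the simplex.
\<close>

definition shrinking_squares :: "real \<times> (real ^ 'n::finite) \<Rightarrow> real ^ 'n" where
  "shrinking_squares = (\<lambda>(t, x). \<chi> i. (1 - t) * (x $ i)\<^sup>2 + t * (1 / (1 + real CARD('n))))"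

lemma continuous_coeff_polynomial_shrinking_squares:
  "continuous_coeff_polynomial
     (\<lambda>t x. shrinking_squares (t, x :: real ^ 'n::finite) $ i)"
proof -
  \<comment> \<open>Only the exponents of \<open>x\<^sub>i\<^sup>2\<close> and of the constant monomial occur.\<close>
  define \<beta> :: "'n \<Rightarrow> nat" where "\<beta> = (\<lambda>j. if j = i then 2 else 0)"
  define c where "c \<alpha> t = (if \<alpha> = \<beta> then 1 - t else t * (1 / (1 + real CARD('n))))"
    for \<alpha> :: "'n \<Rightarrow> nat" and t :: real
  have ne: "\<beta> \<noteq> (\<lambda>_. 0)" by (auto simp: \<beta>_def fun_eq_iff)
  have "(\<Prod>j\<in>UNIV. x $ j ^ \<beta> j) = (x $ i)\<^sup>2" for x :: "real ^ 'n"
    by (simp add: \<beta>_def if_distrib[of "\<lambda>k. _ ^ k"] cong: if_cong)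
  then have "shrinking_squares (t, x) $ i = (\<Sum>\<alpha>\<in>{\<beta>, \<lambda>_. 0}. c \<alpha> t * (\<Prod>j\<in>UNIV. x $ j ^ \<alpha> j))" for t x
    using ne by (auto simp: c_def shrinking_squares_def)
  moreover have "continuous_on {0..1} (c \<alpha>)" for \<alpha>
    by (cases "\<alpha> = \<beta>") (auto simp: c_def[abs_def] intro!: continuous_intros)
  ultimately show ?thesis unfolding continuous_coeff_polynomial_def
    by (intro exI[of _ "{\<beta>, \<lambda>_. 0}"] exI[of _ c]) auto
qed

lemma squares_image_cball:
  "shrinking_squares ` ({0} \<times> cball 0 1) = (std_simplex :: (real ^ 'n::finite) set)"
proof
  show "shrinking_squares ` ({0} \<times> cball 0 1) \<subseteq> (std_simplex :: (real ^ 'n) set)"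
    unfolding image_subset_iff
    by (auto simp: shrinking_squares_def std_simplex_def sum_squares_le_one_iff simp del: mem_cball_0 mem_cball)
  show "(std_simplex :: (real ^ 'n) set) \<subseteq> shrinking_squares ` ({0} \<times> cball 0 1)"
  proof
    fix y :: "real ^ 'n" assume y: "y \<in> std_simplex"
    let ?x = "\<chi> i. sqrt (y $ i)"
    have "?x \<in> cball 0 1" unfolding sum_squares_le_one_iff using y by (simp add: std_simplex_def)
    moreover have "y = shrinking_squares (0, ?x)"
      using y by (simp add: shrinking_squares_def std_simplex_def vec_eq_iff)
    ultimately show "y \<in> shrinking_squares ` ({0} \<times> cball 0 1)" by blast
  qed
qed

lemma shrinking_squares_interior:
  fixes x :: "real ^ 'n::finite"
  assumes "0 < t" "t \<le> 1" "x \<in> cball 0 1"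
  shows "shrinking_squares (t, x) \<in> interior std_simplex"
proof (rule interior_std_simplexI)
  let ?n = "real CARD('n)"
  show "0 < shrinking_squares (t, x) $ i" for i
    using assms by (simp add: shrinking_squares_def add_nonneg_pos)
  have "(\<Sum>i\<in>UNIV. shrinking_squares (t, x) $ i)
      = (1 - t) * (\<Sum>i\<in>UNIV. (x $ i)\<^sup>2) + t * (?n / (1 + ?n))"
    by (simp add: shrinking_squares_def sum.distrib sum_distrib_left)
  also have "\<dots> \<le> (1 - t) * 1 + t * (?n / (1 + ?n))"
    using assms(2,3) by (intro add_right_mono mult_left_mono) (auto simp only: sum_squares_le_one_iff)
  also have "\<dots> < (1 - t) * 1 + t * 1"
    using assms(1) by (intro add_strict_left_mono mult_strict_left_mono) (auto simp: divide_simps)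
  finally show "(\<Sum>i\<in>UNIV. shrinking_squares (t, x) $ i) < 1" by simp
qed

theorem lemma2p5:
  shows "brick TYPE('n::finite) (std_simplex :: (real ^ 'n) set)"
  unfolding brick_def
proof (intro conjI exI[of _ "shrinking_squares :: real \<times> (real ^ 'n) \<Rightarrow> real ^ 'n"])
  let ?H = "shrinking_squares :: real \<times> (real ^ 'n) \<Rightarrow> real ^ 'n"
  show "semialgebraic (std_simplex :: (real ^ 'n) set)" by (rule semialgebraic_std_simplex)
  show "semialgebraic_dim (std_simplex :: (real ^ 'n) set) = enat CARD('n)"
    by (rule semialgebraic_dim_std_simplex)
  show "continuous_on ({0..1} \<times> cball 0 1) ?H"
    unfolding shrinking_squares_def case_prod_unfold by (intro continuous_intros)
  show image0: "?H ` ({0} \<times> cball 0 1) = std_simplex" by (rule squares_image_cball)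
  show "?H ` ({0..1} \<times> cball 0 1) \<subseteq> std_simplex"
  proof clarify
    fix t and x :: "real ^ 'n" assume tx: "t \<in> {0..1 :: real}" "x \<in> cball 0 1"
    show "?H (t, x) \<in> std_simplex"
    proof (cases "t = 0")
      case True
      then show ?thesis using image0 tx(2) by blast
    next
      case False
      then show ?thesis using shrinking_squares_interior[of t x] tx interior_subset by auto
    qed
  qed
  show "\<forall>i. \<exists>p. continuous_coeff_polynomial p \<and>
      (\<forall>t\<in>{0..1}. \<forall>x\<in>cball 0 1. ?H (t, x) $ i = p t x)"
    using continuous_coeff_polynomial_shrinking_squares by blast
  show "\<exists>a. \<forall>x\<in>cball 0 1. ?H (1, x) = a" by (simp add: shrinking_squares_def)
  show "\<forall>t\<in>{0<..<1}. ?H ` ({t} \<times> cball 0 1) \<subseteq> interior std_simplex"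
    by (auto intro!: shrinking_squares_interior simp del: mem_cball_0 mem_cball)
qed

end
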